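(* Let $(A,J)$ and $(B,K)$ be flip pairs and let $l$ be a positive integer. If there is a $D_\infty$-strong shift equivalence of lag $l$ from $(A,J)$ to $(B,K)$, then there is a $D_\infty$-shift equivalence of lag $l$ from $(A,J)$ to $(B,K)$.
   Context: For a finite set $\mathcal{A}$, a pair $(A,J)$ of zero-one $\mathcal{A}\times\mathcal{A}$ matrices is a flip pair if $JA=A^{\mathsf T}J$ and $J^2=I$. Let $(A,J)$ and $(B,K)$ be flip pairs, indexed by finite sets $\mathcal{A}$ and $\mathcal{B}$ respectively. A half elementary equivalence from $(A,J)$ to $(B,K)$ is a pair $(R,S)$ of zero-one matrices ($R$ is $\mathcal{A}\times\mathcal{B}$, $S$ is $\mathcal{B}\times\mathcal{A}$) satisfying $A=RS$, $B=SR$ and $S=KR^{\mathsf T}J$. A $D_\infty$-strong shift equivalence of lag $l$ from $(A,J)$ to $(B,K)$ is a sequence of $l$ half elementary equivalences $(R_i,S_i)$ from $(A_i,J_i)$ to $(A_{i+1},J_{i+1})$, $i=1,\dots,l$, where the $(A_i,J_i)$ are flip pairs, $(A_1,J_1)=(A,J)$ and $(A_{l+1},J_{l+1})=(B,K)$. A $D_\infty$-shift equivalence of lag $l$ from $(A,J)$ to $(B,K)$ is a pair $(R,S)$ of nonnegative integral matrices ($R$ is $\mathcal{A}\times\mathcal{B}$, $S$ is $\mathcal{B}\times\mathcal{A}$) satisfying $A^l=RS$, $B^l=SR$, $AR=RB$ and $S=KR^{\mathsf T}J$. *)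

theory Defs
  imports Main
begin

text \<open>
  A matrix with rows indexed by a set \<open>X\<close> and columns indexed by a set \<open>Y\<close> is a
  function of two arguments that is \<open>0\<close> outside \<open>X \<times> Y\<close>. This makes such functions
  correspond one-to-one to integer \<open>X \<times> Y\<close> matrices, so that equality of matrices is
  equality of functions. Index sets are explicit because a chain of
  equivalences passes through index sets of varying size.
\<close>

definition int_mat :: "'a set \<Rightarrow> 'b set \<Rightarrow> ('a \<Rightarrow> 'b \<Rightarrow> int) \<Rightarrow> bool" where
  "int_mat X Y M \<longleftrightarrow> (\<forall>x y. x \<notin> X \<or> y \<notin> Y \<longrightarrow> M x y = 0)"

definition zero_one_mat :: "'a set \<Rightarrow> 'b set \<Rightarrow> ('a \<Rightarrow> 'b \<Rightarrow> int) \<Rightarrow> bool" where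
  "zero_one_mat X Y M \<longleftrightarrow> int_mat X Y M \<and> (\<forall>x\<in>X. \<forall>y\<in>Y. M x y \<in> {0, 1})"

definition nonneg_mat :: "'a set \<Rightarrow> 'b set \<Rightarrow> ('a \<Rightarrow> 'b \<Rightarrow> int) \<Rightarrow> bool" where
  "nonneg_mat X Y M \<longleftrightarrow> int_mat X Y M \<and> (\<forall>x\<in>X. \<forall>y\<in>Y. 0 \<le> M x y)"

text \<open>The set argument of the product is the common (inner) index set.\<close>

definition mmult ::
  "'b set \<Rightarrow> ('a \<Rightarrow> 'b \<Rightarrow> int) \<Rightarrow> ('b \<Rightarrow> 'c \<Rightarrow> int) \<Rightarrow> 'a \<Rightarrow> 'c \<Rightarrow> int" where
  "mmult Y M N = (\<lambda>x z. \<Sum>y\<in>Y. M x y * N y z)"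

definition mtranspose :: "('a \<Rightarrow> 'b \<Rightarrow> int) \<Rightarrow> 'b \<Rightarrow> 'a \<Rightarrow> int" where
  "mtranspose M = (\<lambda>y x. M x y)"

definition mid :: "'a set \<Rightarrow> 'a \<Rightarrow> 'a \<Rightarrow> int" where
  "mid X = (\<lambda>x y. if x \<in> X \<and> x = y then 1 else 0)"

primrec mpow :: "'a set \<Rightarrow> ('a \<Rightarrow> 'a \<Rightarrow> int) \<Rightarrow> nat \<Rightarrow> 'a \<Rightarrow> 'a \<Rightarrow> int" where
  "mpow X M 0 = mid X"
| "mpow X M (Suc n) = mmult X (mpow X M n) M"

definition flip_pair :: "'a set \<Rightarrow> ('a \<Rightarrow> 'a \<Rightarrow> int) \<Rightarrow> ('a \<Rightarrow> 'a \<Rightarrow> int) \<Rightarrow> bool" where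
  "flip_pair X A J \<longleftrightarrow>
     finite X \<and> zero_one_mat X X A \<and> zero_one_mat X X J \<and>
     mmult X J A = mmult X (mtranspose A) J \<and>
     mmult X J J = mid X"

definition half_elementary_equivalence ::
  "'a set \<Rightarrow> ('a \<Rightarrow> 'a \<Rightarrow> int) \<Rightarrow> ('a \<Rightarrow> 'a \<Rightarrow> int) \<Rightarrow>
   'b set \<Rightarrow> ('b \<Rightarrow> 'b \<Rightarrow> int) \<Rightarrow> ('b \<Rightarrow> 'b \<Rightarrow> int) \<Rightarrow>
   ('a \<Rightarrow> 'b \<Rightarrow> int) \<Rightarrow> ('b \<Rightarrow> 'a \<Rightarrow> int) \<Rightarrow> bool" where
  "half_elementary_equivalence X A J Y B K R S \<longleftrightarrow>
     zero_one_mat X Y R \<and> zero_one_mat Y X S \<and>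
     A = mmult Y R S \<and> B = mmult X S R \<and>
     S = mmult X (mmult Y K (mtranspose R)) J"

text \<open>
  All index sets of a chain are subsets of one type \<open>'a\<close>, which is arbitrary; finitely
  many finite sets can always be placed in a common type, such as \<^typ>\<open>nat\<close>.
\<close>

definition D_infinity_strong_shift_equivalent ::
  "nat \<Rightarrow> 'a set \<Rightarrow> ('a \<Rightarrow> 'a \<Rightarrow> int) \<Rightarrow> ('a \<Rightarrow> 'a \<Rightarrow> int) \<Rightarrow>
   'a set \<Rightarrow> ('a \<Rightarrow> 'a \<Rightarrow> int) \<Rightarrow> ('a \<Rightarrow> 'a \<Rightarrow> int) \<Rightarrow> bool" where
  "D_infinity_strong_shift_equivalent l X A J Y B K \<longleftrightarrow>
     (\<exists>(Xs :: nat \<Rightarrow> 'a set) As Js Rs Ss.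
        (\<forall>i\<in>{1..l + 1}. flip_pair (Xs i) (As i) (Js i)) \<and>
        Xs 1 = X \<and> As 1 = A \<and> Js 1 = J \<and>
        Xs (l + 1) = Y \<and> As (l + 1) = B \<and> Js (l + 1) = K \<and>
        (\<forall>i\<in>{1..l}. half_elementary_equivalence
            (Xs i) (As i) (Js i) (Xs (i + 1)) (As (i + 1)) (Js (i + 1)) (Rs i) (Ss i)))"

definition D_infinity_shift_equivalence ::
  "nat \<Rightarrow> 'a set \<Rightarrow> ('a \<Rightarrow> 'a \<Rightarrow> int) \<Rightarrow> ('a \<Rightarrow> 'a \<Rightarrow> int) \<Rightarrow>
   'b set \<Rightarrow> ('b \<Rightarrow> 'b \<Rightarrow> int) \<Rightarrow> ('b \<Rightarrow> 'b \<Rightarrow> int) \<Rightarrow>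
   ('a \<Rightarrow> 'b \<Rightarrow> int) \<Rightarrow> ('b \<Rightarrow> 'a \<Rightarrow> int) \<Rightarrow> bool" where
  "D_infinity_shift_equivalence l X A J Y B K R S \<longleftrightarrow>
     nonneg_mat X Y R \<and> nonneg_mat Y X S \<and>
     mpow X A l = mmult Y R S \<and> mpow Y B l = mmult X S R \<and>
     mmult X A R = mmult Y R B \<and>
     S = mmult X (mmult Y K (mtranspose R)) J"

end

theory Submission
  imports Defs
begin

text \<open>
  Take \<open>R = R\<^sub>1 \<cdots> R\<^sub>l\<close> and \<open>S = S\<^sub>l \<cdots> S\<^sub>1\<close>. In \<open>S\<close> the inner flips cancel because
  they are involutions, which leaves \<open>S = K R\<^sup>T J\<close>; the other identities follow
  from \<open>A\<^sub>i R\<^sub>i = R\<^sub>i S\<^sub>i R\<^sub>i = R\<^sub>i A\<^sub>i\<^sub>+\<^sub>1\<close>. The induction on the lag starts at \<open>0\<close>, where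
  \<open>R = S = I\<close>.
\<close>

lemma mmult_assoc: "mmult Z (mmult Y M N) P = mmult Y M (mmult Z N P)"
proof (intro ext)
  fix x w
  have "mmult Z (mmult Y M N) P x w = (\<Sum>z\<in>Z. \<Sum>y\<in>Y. M x y * N y z * P z w)"
    by (simp add: mmult_def sum_distrib_right)
  also have "\<dots> = (\<Sum>y\<in>Y. \<Sum>z\<in>Z. M x y * N y z * P z w)"
    by (rule sum.swap)
  also have "\<dots> = mmult Y M (mmult Z N P) x w"
    by (simp add: mmult_def sum_distrib_left mult.assoc)
  finally show "mmult Z (mmult Y M N) P x w = mmult Y M (mmult Z N P) x w" .
qed

lemma mtranspose_mmult:
  "mtranspose (mmult Y M N) = mmult Y (mtranspose N) (mtranspose M)"
  by (simp add: mtranspose_def mmult_def mult.commute)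

lemma mtranspose_mid [simp]: "mtranspose (mid X) = mid X"
  by (auto simp: mtranspose_def mid_def fun_eq_iff)

lemma int_mat_mtranspose: "int_mat X Y M \<Longrightarrow> int_mat Y X (mtranspose M)"
  by (auto simp: int_mat_def mtranspose_def)

text \<open>In a row \<open>x\<close> outside \<open>X\<close> the product is zero, so the identity
  law rests on \<open>M\<close> vanishing there, which \<open>int_mat\<close> guarantees.\<close>

lemma mmult_mid_left:
  assumes "finite X" "int_mat X Y M"
  shows "mmult X (mid X) M = M"
proof (intro ext)
  fix x y
  have "mmult X (mid X) M x y = (\<Sum>z\<in>X. if x = z then M z y else 0)"
    unfolding mmult_def mid_def by (rule sum.cong) auto
  also have "\<dots> = M x y"
    using assms by (simp add: int_mat_def)
  finally show "mmult X (mid X) M x y = M x y" .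
qed

lemma mmult_mid_right:
  assumes "finite Y" "int_mat X Y M"
  shows "mmult Y M (mid Y) = M"
proof -
  \<comment> \<open>Transposition reverses products and fixes \<open>mid Y\<close>, which reduces
    the claim to the left identity law.\<close>
  have "mtranspose (mmult Y M (mid Y)) = mtranspose M"
    using mmult_mid_left[OF assms(1) int_mat_mtranspose[OF assms(2)]]
    by (simp add: mtranspose_mmult)
  then show ?thesis
    by (simp add: mtranspose_def fun_eq_iff)
qed

lemma int_mat_mid: "int_mat X X (mid X)"
  by (auto simp: int_mat_def mid_def)

lemma nonneg_mat_mid: "nonneg_mat X X (mid X)"
  by (auto simp: nonneg_mat_def int_mat_def mid_def)

lemma nonneg_mat_mmult:
  assumes "nonneg_mat X Y M" "nonneg_mat Y Z N"
  shows "nonneg_mat X Z (mmult Y M N)"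
  using assms by (auto simp: nonneg_mat_def int_mat_def mmult_def intro!: sum_nonneg)

lemma zero_one_mat_imp_nonneg_mat: "zero_one_mat X Y M \<Longrightarrow> nonneg_mat X Y M"
  by (force simp: zero_one_mat_def nonneg_mat_def)

lemma zero_one_mat_imp_int_mat: "zero_one_mat X Y M \<Longrightarrow> int_mat X Y M"
  by (simp add: zero_one_mat_def)

text \<open>Each factor \<open>A\<close> passes through \<open>R\<close> and comes out as
  \<open>B\<close>. In the composition of equivalences this carries \<open>R'\<close> across a
  power.\<close>

lemma mpow_intertwine:
  assumes "finite X" "finite Y" "int_mat X Y R" "mmult X A R = mmult Y R B"
  shows "mmult X (mpow X A n) R = mmult Y R (mpow Y B n)"
proof (induction n)
  case 0
  then show ?case
    using mmult_mid_left[OF assms(1,3)] mmult_mid_right[OF assms(2,3)] by simp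
next
  case (Suc n)
  have "mmult X (mpow X A (Suc n)) R = mmult X (mpow X A n) (mmult Y R B)"
    using assms(4) by (simp add: mmult_assoc)
  also have "\<dots> = mmult Y (mmult X (mpow X A n) R) B"
    by (simp add: mmult_assoc)
  also have "\<dots> = mmult Y R (mpow Y B (Suc n))"
    by (simp add: Suc.IH mmult_assoc)
  finally show ?case .
qed

text \<open>\<open>mpow\<close> adds factors on the right; intertwining \<open>A\<close> with itself
  moves the new factor to the left.\<close>

lemma mpow_Suc_left:
  assumes "finite X" "int_mat X X A"
  shows "mpow X A (Suc n) = mmult X A (mpow X A n)"
  using mpow_intertwine[OF assms(1,1,2) refl] by simp

text \<open>With \<open>R = I\<close> the flip condition reads \<open>I = J I J\<close>, which is
  \<open>J J = I\<close>.\<close>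

lemma D_infinity_shift_equivalence_0:
  assumes "flip_pair X A J"
  shows "D_infinity_shift_equivalence 0 X A J X A J (mid X) (mid X)"
proof -
  have X: "finite X" and A: "int_mat X X A" and J: "int_mat X X J"
    and JJ: "mmult X J J = mid X"
    using assms by (simp_all add: flip_pair_def zero_one_mat_imp_int_mat)
  show ?thesis
    unfolding D_infinity_shift_equivalence_def
    by (simp add: JJ nonneg_mat_mid mmult_mid_left[OF X int_mat_mid]
        mmult_mid_left[OF X A] mmult_mid_right[OF X A] mmult_mid_right[OF X J])
qed

text \<open>The lag grows by one because \<open>A R S = R B S\<close>, and the \<open>B\<close> in
  the middle splits as \<open>R' S'\<close>.\<close>

lemma D_infinity_shift_equivalence_Suc:
  assumes X: "flip_pair X A J" and Y: "flip_pair Y B K" and Z: "flip_pair Z C L"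
    and se: "D_infinity_shift_equivalence n X A J Y B K R S"
    and he: "half_elementary_equivalence Y B K Z C L R' S'"
  shows "D_infinity_shift_equivalence (Suc n) X A J Z C L (mmult Y R R') (mmult Y S' S)"
proof -
  have fin: "finite X" "finite Y" "finite Z"
    and A: "int_mat X X A" and C: "int_mat Z Z C" and KK: "mmult Y K K = mid Y"
    using X Y Z by (simp_all add: flip_pair_def zero_one_mat_imp_int_mat)
  have RS: "mpow X A n = mmult Y R S" and SR: "mpow Y B n = mmult X S R"
    and AR: "mmult X A R = mmult Y R B" and S: "S = mmult X (mmult Y K (mtranspose R)) J"
    and nn: "nonneg_mat X Y R" "nonneg_mat Y X S"
    using se unfolding D_infinity_shift_equivalence_def by auto
  have B_eq: "B = mmult Z R' S'" and C_eq: "C = mmult Y S' R'"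
    and S': "S' = mmult Y (mmult Z L (mtranspose R')) K"
    and zo: "zero_one_mat Y Z R'" "zero_one_mat Z Y S'"
    using he unfolding half_elementary_equivalence_def by auto
  have int: "int_mat Y Z R'" "int_mat X Y R"
    using nn zo by (simp_all add: zero_one_mat_imp_int_mat nonneg_mat_def)
  have BR': "mmult Y B R' = mmult Z R' C"
    by (simp add: B_eq C_eq mmult_assoc)
  have "mpow X A (Suc n) = mmult X A (mmult Y R S)"
    using RS mpow_Suc_left[OF fin(1) A, of n] by simp
  also have "\<dots> = mmult Y (mmult X A R) S"
    by (simp add: mmult_assoc)
  also have "\<dots> = mmult Z (mmult Y R R') (mmult Y S' S)"
    by (subst AR) (simp add: B_eq mmult_assoc)
  finally have 1: "mpow X A (Suc n) = mmult Z (mmult Y R R') (mmult Y S' S)" .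
  have "mpow Z C (Suc n) = mmult Z (mmult Y S' R') (mpow Z C n)"
    using C_eq mpow_Suc_left[OF fin(3) C, of n] by simp
  \<comment> \<open>Pulling \<open>R'\<close> to the right through the power of \<open>C\<close>
    leaves the same power of \<open>B\<close>, which factors as \<open>S R\<close>.\<close>
  also have "\<dots> = mmult Y S' (mmult Y (mpow Y B n) R')"
    by (simp add: mmult_assoc mpow_intertwine[OF fin(2,3) int(1) BR'])
  also have "\<dots> = mmult X (mmult Y S' S) (mmult Y R R')"
    by (simp add: SR mmult_assoc)
  finally have 2: "mpow Z C (Suc n) = mmult X (mmult Y S' S) (mmult Y R R')" .
  have "mmult X A (mmult Y R R') = mmult Y (mmult X A R) R'"
    by (simp add: mmult_assoc)
  also have "\<dots> = mmult Z (mmult Y R R') C"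
    by (simp add: AR BR' mmult_assoc)
  finally have 3: "mmult X A (mmult Y R R') = mmult Z (mmult Y R R') C" .
  \<comment> \<open>\<open>S'\<close> ends in \<open>K\<close> and \<open>S\<close> begins with
    \<open>K\<close>; bracketing the two together exposes the involution.\<close>
  have "mmult Y S' S = mmult Z L (mmult Y (mtranspose R')
      (mmult Y (mmult Y K K) (mmult X (mtranspose R) J)))"
    by (subst S, subst S') (simp add: mmult_assoc)
  also have "\<dots> = mmult Z L (mmult Y (mtranspose R')
      (mmult X (mmult Y (mid Y) (mtranspose R)) J))"
    by (simp add: KK mmult_assoc)
  also have "mmult Y (mid Y) (mtranspose R) = mtranspose R"
    by (rule mmult_mid_left[OF fin(2) int_mat_mtranspose[OF int(2)]])
  finally have 4: "mmult Y S' S = mmult X (mmult Z L (mtranspose (mmult Y R R'))) J"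
    by (simp add: mtranspose_mmult mmult_assoc)
  \<comment> \<open>Products of zero-one matrices may have larger entries; nonnegativity is what
    survives.\<close>
  have "nonneg_mat X Z (mmult Y R R')" "nonneg_mat Z X (mmult Y S' S)"
    using nn zo by (auto intro: nonneg_mat_mmult zero_one_mat_imp_nonneg_mat)
  with 1 2 3 4 show ?thesis
    unfolding D_infinity_shift_equivalence_def by blast
qed

theorem mainTheorem4:
  fixes X Y :: "'a set"
    and A J B K :: "'a \<Rightarrow> 'a \<Rightarrow> int"
    and l :: nat
  assumes "flip_pair X A J"
    and "flip_pair Y B K"
    and "l > 0"
    and "D_infinity_strong_shift_equivalent l X A J Y B K"
  shows "\<exists>R S. D_infinity_shift_equivalence l X A J Y B K R S"
proof -
  obtain Xs :: "nat \<Rightarrow> 'a set" and As Js Rs Ss where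
    fp: "\<And>i. i \<in> {1..l + 1} \<Longrightarrow> flip_pair (Xs i) (As i) (Js i)"
    and first: "Xs 1 = X" "As 1 = A" "Js 1 = J"
    and last: "Xs (l + 1) = Y" "As (l + 1) = B" "Js (l + 1) = K"
    and he: "\<And>i. i \<in> {1..l} \<Longrightarrow> half_elementary_equivalence
      (Xs i) (As i) (Js i) (Xs (i + 1)) (As (i + 1)) (Js (i + 1)) (Rs i) (Ss i)"
    using assms(4) unfolding D_infinity_strong_shift_equivalent_def by blast
  \<comment> \<open>The induction runs over initial segments of the chain. Since the chain is
    numbered from 1, its first \<open>n\<close> links end at index \<open>n + 1\<close>, and
    \<open>n \<le> l\<close> keeps every index in range.\<close>
  have "\<exists>R S. D_infinity_shift_equivalence n X A J
      (Xs (n + 1)) (As (n + 1)) (Js (n + 1)) R S" if "n \<le> l" for n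
    using that
  proof (induction n)
    case 0
    then show ?case
      using D_infinity_shift_equivalence_0[OF assms(1)] first by auto
  next
    case (Suc n)
    then obtain R S where se: "D_infinity_shift_equivalence n X A J
        (Xs (n + 1)) (As (n + 1)) (Js (n + 1)) R S"
      by auto
    have "flip_pair (Xs (n + 1)) (As (n + 1)) (Js (n + 1))"
      "flip_pair (Xs (n + 1 + 1)) (As (n + 1 + 1)) (Js (n + 1 + 1))"
      using Suc.prems by (auto intro!: fp)
    moreover have "half_elementary_equivalence (Xs (n + 1)) (As (n + 1)) (Js (n + 1))
        (Xs (n + 1 + 1)) (As (n + 1 + 1)) (Js (n + 1 + 1)) (Rs (n + 1)) (Ss (n + 1))"
      using Suc.prems by (intro he) auto
    ultimately have "D_infinity_shift_equivalence (Suc n) X A J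
        (Xs (n + 1 + 1)) (As (n + 1 + 1)) (Js (n + 1 + 1))
        (mmult (Xs (n + 1)) R (Rs (n + 1))) (mmult (Xs (n + 1)) (Ss (n + 1)) S)"
      using D_infinity_shift_equivalence_Suc[OF assms(1) _ _ se] by blast
    then show ?case
      by auto
  qed
  from this[of l] show ?thesis
    using last by simp
qed

end
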